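(* Let $M$ be a submonoid of a monoid $A$. Then $M$ is the zero-class of the reflexive relation $R_M$ if and only if the following condition holds: (R) for every $x,y\in A$ and every $u\in M$, $\;xy=1\Rightarrow xuy\in M$. If $M$ is a clot then $M=[1]_{R_M}$, and the converse holds when the relation $R_M$ is internal.
   Context: Monoids are written multiplicatively with unit $1$. The reflexive relation $R_M$ on $A$ is defined by: $a\,R_M\,b$ if for every $x,y\in A$, $xay=1\Rightarrow xby\in M$. A relation on $A$ is internal if it is compatible with the monoid operation, i.e. a submonoid of $A\times A$. The zero-class of a relation $S$ on $A$ is $[1]_S=\{u\in A\mid (1,u)\in S\}$. A submonoid $M$ of $A$ is a clot if it is the zero-class of some internal reflexive relation on $A$. *)

theory Defs
  imports "HOL-Algebra.Group"
begin

definition clot_rel :: "('a, 'm) monoid_scheme \<Rightarrow> 'a set \<Rightarrow> ('a \<times> 'a) set" where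
  "clot_rel A M =
    {(a, b). a \<in> carrier A \<and> b \<in> carrier A \<and>
      (\<forall>x \<in> carrier A. \<forall>y \<in> carrier A.
         x \<otimes>\<^bsub>A\<^esub> a \<otimes>\<^bsub>A\<^esub> y = \<one>\<^bsub>A\<^esub> \<longrightarrow> x \<otimes>\<^bsub>A\<^esub> b \<otimes>\<^bsub>A\<^esub> y \<in> M)}"

definition internal_rel :: "('a, 'm) monoid_scheme \<Rightarrow> ('a \<times> 'a) set \<Rightarrow> bool" where
  "internal_rel A S \<longleftrightarrow> submonoid S (A \<times>\<times> A)"

definition zero_class :: "('a, 'm) monoid_scheme \<Rightarrow> ('a \<times> 'a) set \<Rightarrow> 'a set" where
  "zero_class A S = {u \<in> carrier A. (\<one>\<^bsub>A\<^esub>, u) \<in> S}"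

text \<open>Since \<^const>\<open>refl_on\<close> does not bound the relation, it is \<^const>\<open>internal_rel\<close> that forces
  \<open>S \<subseteq> carrier A \<times> carrier A\<close> below.\<close>

definition clot :: "('a, 'm) monoid_scheme \<Rightarrow> 'a set \<Rightarrow> bool" where
  "clot A M \<longleftrightarrow> submonoid M A \<and>
    (\<exists>S. internal_rel A S \<and> refl_on (carrier A) S \<and> M = zero_class A S)"

lemma refl_on_clot_rel:
  assumes "submonoid M A"
  shows "refl_on (carrier A) (clot_rel A M)"
  using submonoid.one_closed[OF assms] by (auto simp: refl_on_def clot_rel_def)

end

theory Submission
  imports Defs
begin

text \<open>Since x1y = xy, the zero-class of R_M consists of the u with xuy in M whenever xy = 1.
  The choice x = y = 1 puts this class inside M whatever M is
  (\<open>zero_class_clot_rel_subset\<close>), so equality amounts to the reverse inclusion, which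
  is exactly (R) (\<open>zero_class_clot_rel_eq_iff\<close>). A clot satisfies (R) because a
  reflexive internal relation S can be multiplied on both sides by diagonal pairs: from (1, u) in S
  one gets (xy, xuy) in S (\<open>clot_conj_closed\<close>). Conversely, R_M is reflexive because 1
  lies in M, so once it is internal it is itself a relation exhibiting its zero-class as a
  clot.\<close>

lemma zero_class_clot_rel:
  assumes "monoid A"
  shows "zero_class A (clot_rel A M) =
    {u \<in> carrier A. \<forall>x \<in> carrier A. \<forall>y \<in> carrier A.
       x \<otimes>\<^bsub>A\<^esub> y = \<one>\<^bsub>A\<^esub> \<longrightarrow> x \<otimes>\<^bsub>A\<^esub> u \<otimes>\<^bsub>A\<^esub> y \<in> M}"
proof -
  interpret monoid A by fact
  show ?thesis
    by (auto simp: zero_class_def clot_rel_def)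
qed

lemma zero_class_clot_rel_subset:
  assumes "monoid A"
  shows "zero_class A (clot_rel A M) \<subseteq> M"
proof
  interpret monoid A by fact
  fix u
  assume "u \<in> zero_class A (clot_rel A M)"
  \<comment> \<open>Instantiate the condition at x = y = 1, a pair with product 1.\<close>
  then have "u \<in> carrier A" and "\<one>\<^bsub>A\<^esub> \<otimes>\<^bsub>A\<^esub> u \<otimes>\<^bsub>A\<^esub> \<one>\<^bsub>A\<^esub> \<in> M"
    unfolding zero_class_clot_rel[OF assms] using one_closed l_one[OF one_closed] by blast+
  then show "u \<in> M" by simp
qed

lemma zero_class_clot_rel_eq_iff:
  assumes "monoid A" and "M \<subseteq> carrier A"
  shows "M = zero_class A (clot_rel A M) \<longleftrightarrow>
    (\<forall>x \<in> carrier A. \<forall>y \<in> carrier A. \<forall>u \<in> M.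
       x \<otimes>\<^bsub>A\<^esub> y = \<one>\<^bsub>A\<^esub> \<longrightarrow> x \<otimes>\<^bsub>A\<^esub> u \<otimes>\<^bsub>A\<^esub> y \<in> M)"
proof -
  \<comment> \<open>One inclusion is automatic, so only the one expressing (R) remains.\<close>
  have "M = zero_class A (clot_rel A M) \<longleftrightarrow> M \<subseteq> zero_class A (clot_rel A M)"
    using zero_class_clot_rel_subset[OF assms(1), of M] by blast
  then show ?thesis
    using assms(2) unfolding zero_class_clot_rel[OF assms(1)] by blast
qed

lemma internal_rel_mult:
  assumes "internal_rel A S" and "(a, b) \<in> S" and "(c, d) \<in> S"
  shows "(a \<otimes>\<^bsub>A\<^esub> c, b \<otimes>\<^bsub>A\<^esub> d) \<in> S"
  using submonoid.m_closed[OF assms(1)[unfolded internal_rel_def] assms(2,3)]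
  by (simp add: DirProd_def)

text \<open>This is (R) for clots: reflexivity supplies (x, x) and (y, y), and compatibility lets
  them surround (1, u).\<close>

lemma clot_conj_closed:
  assumes "monoid A" and "clot A M"
    and x: "x \<in> carrier A" and y: "y \<in> carrier A" and u: "u \<in> M"
    and xy: "x \<otimes>\<^bsub>A\<^esub> y = \<one>\<^bsub>A\<^esub>"
  shows "x \<otimes>\<^bsub>A\<^esub> u \<otimes>\<^bsub>A\<^esub> y \<in> M"
proof -
  interpret monoid A by fact
  obtain S where S: "internal_rel A S" "refl_on (carrier A) S" "M = zero_class A S"
    using assms(2) unfolding clot_def by blast
  have uA: "u \<in> carrier A" and "(\<one>\<^bsub>A\<^esub>, u) \<in> S"
    using u S(3) by (auto simp: zero_class_def)
  moreover have "(x, x) \<in> S" and "(y, y) \<in> S"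
    using x y S(2) by (auto dest: refl_onD)
  \<comment> \<open>The product (x, x)(1, u)(y, y), by two uses of \<open>internal_rel_mult\<close>;
    its first component collapses to 1 because xy = 1.\<close>
  ultimately have "(x \<otimes>\<^bsub>A\<^esub> \<one>\<^bsub>A\<^esub> \<otimes>\<^bsub>A\<^esub> y, x \<otimes>\<^bsub>A\<^esub> u \<otimes>\<^bsub>A\<^esub> y) \<in> S"
    using internal_rel_mult[OF S(1)] by blast
  then show ?thesis
    using x y uA xy S(3) by (simp add: zero_class_def)
qed

theorem proposition3:
  fixes A :: "('a, 'm) monoid_scheme" and M :: "'a set"
  assumes "monoid A" and "submonoid M A"
  shows "(M = zero_class A (clot_rel A M) \<longleftrightarrow>
            (\<forall>x \<in> carrier A. \<forall>y \<in> carrier A. \<forall>u \<in> M.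
               x \<otimes>\<^bsub>A\<^esub> y = \<one>\<^bsub>A\<^esub> \<longrightarrow> x \<otimes>\<^bsub>A\<^esub> u \<otimes>\<^bsub>A\<^esub> y \<in> M))
       \<and> (clot A M \<longrightarrow> M = zero_class A (clot_rel A M))
       \<and> (internal_rel A (clot_rel A M) \<longrightarrow>
            (M = zero_class A (clot_rel A M) \<longrightarrow> clot A M))"
proof (intro conjI impI)
  note iff = zero_class_clot_rel_eq_iff[OF assms(1) submonoid.subset[OF assms(2)]]
  show "M = zero_class A (clot_rel A M) \<longleftrightarrow>
            (\<forall>x \<in> carrier A. \<forall>y \<in> carrier A. \<forall>u \<in> M.
               x \<otimes>\<^bsub>A\<^esub> y = \<one>\<^bsub>A\<^esub> \<longrightarrow> x \<otimes>\<^bsub>A\<^esub> u \<otimes>\<^bsub>A\<^esub> y \<in> M)"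
    by (rule iff)
  show "M = zero_class A (clot_rel A M)" if "clot A M"
    using clot_conj_closed[OF assms(1) that] iff by blast
  \<comment> \<open>The witness for the relation S in \<open>clot\<close> is
    \<open>clot_rel A M\<close>.\<close>
  show "clot A M"
    if "internal_rel A (clot_rel A M)" and "M = zero_class A (clot_rel A M)"
    using that assms(2) refl_on_clot_rel[OF assms(2)] unfolding clot_def by blast
qed

end
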